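(* Let $d\ge4$, $\mathcal D=\{1,\ldots,d\}$, and let $\mathbf X=(X_1,\ldots,X_d)$ have standard exponential margins and joint density $f$ given by a $d$-dimensional $C$-vine (with successive root variables $1,2,\ldots,d-1$) in which every pair copula is an inverted extreme value copula, the pair copula for the edge $\{k,j\mid 1,\ldots,k-1\}$ ($k<j$) having exponent measure $V^{\{k,j\mid1,\ldots,k-1\}}$. Let $g_{\mathcal D\setminus\{d\}}$, $g_{\mathcal D\setminus\{d-1\}}$, $g_{\mathcal D\setminus\{d-1,d\}}$ denote the gauge functions of the corresponding sub-vine densities. Then the gauge function of $f$ is $$g(\mathbf x)=g_{\mathcal D\setminus\{d-1,d\}}(\mathbf x_{-\{d-1,d\}})+V^{\{d-1,d\mid\mathcal D\setminus\{d-1,d\}\}}\left\{\frac{1}{g_{\mathcal D\setminus\{d\}}(\mathbf x_{-\{d\}})-g_{\mathcal D\setminus\{d-1,d\}}(\mathbf x_{-\{d-1,d\}})},\ \frac{1}{g_{\mathcal D\setminus\{d-1\}}(\mathbf x_{-\{d-1\}})-g_{\mathcal D\setminus\{d-1,d\}}(\mathbf x_{-\{d-1,d\}})}\right\},$$ with $x_i\ge0$, $i=1,\ldots,d$.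
   Context: Notation: $\mathbf x_{\mathcal C}=(x_i:i\in\mathcal C)$ and $\mathbf x_{-\mathcal C}=(x_i:i\in\mathcal D\setminus\mathcal C)$. The gauge function of a density $f_{\mathcal C}$ (standard exponential margins) is the function $g_{\mathcal C}$, homogeneous of order 1, with $-\ln f_{\mathcal C}(t\mathbf x_{\mathcal C})\sim t g_{\mathcal C}(\mathbf x_{\mathcal C})$ as $t\to\infty$. Exponent measure: $V(x,y)=2\int_0^1\max\left(\frac wx,\frac{1-w}{y}\right)dH(w)$, $x,y>0$, where the spectral distribution $H$ is a probability distribution on $[0,1]$ with $\int_0^1 w\,dH(w)=1/2$. The derivatives $V_1,V_2,V_{12}$ of $V$ with respect to the first, second and both arguments are assumed to exist. Where a coordinate or a difference of gauge functions is $0$, its reciprocal is read as $\infty$ and $V$ is evaluated by the same integral (with $w/\infty=(1-w)/\infty=0$). Inverted extreme value copula with exponent measure $V$: $C(u,v)=u+v-1+\exp\left[-V\left\{\frac{-1}{\ln(1-u)},\frac{-1}{\ln(1-v)}\right\}\right]$, with density $c=\partial^2C/\partial u\,\partial v$. $C$-vine density: for $k<j$ put $R_k=\{1,\ldots,k-1\}$ and let $C_{kj|R_k}$ be the pair copula (not depending on the values of the conditioning variables) with density $c_{kj|R_k}$ and exponent measure $V^{\{k,j\mid R_k\}}$. Marginally $F_i(x)=1-e^{-x}$, $f_i(x)=e^{-x}$; $F_{j|\emptyset}=F_j$ and recursively, for $j>k$, $F_{j|R_k\cup\{k\}}=\partial_1C_{kj|R_k}(F_{k|R_k},F_{j|R_k})$,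 where $F_{j|R}=F_{j|R}(x_j\mid\mathbf x_R)$. Then $$f(\mathbf x)=\prod_{i=1}^d f_i(x_i)\prod_{1\le k<j\le d}c_{kj|R_k}\left\{F_{k|R_k}(x_k\mid\mathbf x_{R_k}),F_{j|R_k}(x_j\mid\mathbf x_{R_k})\right\}.$$ For $\mathcal C=\mathcal D\setminus\{d\}$, $\mathcal D\setminus\{d-1\}$ or $\mathcal D\setminus\{d-1,d\}$ the sub-vine density $f_{\mathcal C}$ is the same product restricted to indices in $\mathcal C$ (the marginal density of $\mathbf X_{\mathcal C}$); it is again a $C$-vine density.
   Formalization: The formal version additionally assumes f > 0 for all x_i > 0 and that each V_12 is continuous (the claim fails otherwise), and requires -ln f(tx) ~ t g(x) only for x_i > 0, gauge functions being continuous and so fixed where some x_i = 0. *)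

theory Defs
  imports "HOL-Probability.Probability" "HOL-Library.Landau_Symbols"
begin

section \<open>Exponent measures\<close>

definition spectral_distribution :: "real measure \<Rightarrow> bool" where
  "spectral_distribution H \<longleftrightarrow>
     real_distribution H \<and> (AE w in H. 0 \<le> w \<and> w \<le> 1) \<and> (\<integral>w. w \<partial>H) = 1 / 2"

text \<open>The arguments are extended reals, so that an argument \<^term>\<open>\<infinity>\<close> gives
  \<^prop>\<open>ereal w / \<infinity> = 0\<close>; in particular \<^term>\<open>1 / ereal 0\<close> is \<^term>\<open>\<infinity>\<close>.\<close>

definition exponent_measure :: "real measure \<Rightarrow> ereal \<Rightarrow> ereal \<Rightarrow> real" where
  "exponent_measure H x y =
     2 * (\<integral>w. real_of_ereal (max (ereal w / x) (ereal (1 - w) / y)) \<partial>H)"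

lemma exponent_measure_ereal:
  assumes "0 < x" "0 < y"
  shows "exponent_measure H (ereal x) (ereal y) = 2 * (\<integral>w. max (w / x) ((1 - w) / y) \<partial>H)"
proof -
  have "real_of_ereal (max (ereal w / ereal x) (ereal (1 - w) / ereal y)) = max (w / x) ((1 - w) / y)" for w
    using assms by (simp flip: ereal_max)
  then show ?thesis
    by (simp only: exponent_measure_def)
qed

lemma exponent_measure_inverse:
  assumes "0 \<le> a" "0 \<le> b"
  shows "exponent_measure H (1 / ereal a) (1 / ereal b) = 2 * (\<integral>w. max (w * a) ((1 - w) * b) \<partial>H)"
proof -
  have *: "ereal w / (1 / ereal c) = ereal (w * c)" if "0 \<le> c" for w c :: real
    using that by (cases "c = 0") (auto simp: one_ereal_def zero_ereal_def)
  have "real_of_ereal (max (ereal w / (1 / ereal a)) (ereal (1 - w) / (1 / ereal b))) =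
      max (w * a) ((1 - w) * b)" for w
    unfolding *[OF assms(1)] *[OF assms(2)] by (simp flip: ereal_max)
  then show ?thesis
    by (simp only: exponent_measure_def)
qed

text \<open>Existence of the partial derivatives \<^emph>\<open>V1\<close>, \<^emph>\<open>V2\<close>, \<^emph>\<open>V12\<close> on the open positive
  quadrant, with \<^emph>\<open>V12\<close> continuous.\<close>

definition regular_exponent :: "(ereal \<Rightarrow> ereal \<Rightarrow> real) \<Rightarrow> bool" where
  "regular_exponent V \<longleftrightarrow>
     (\<forall>x>0. \<forall>y>0.
        (\<lambda>s::real. V (ereal s) (ereal y)) differentiable (at x) \<and>
        (\<lambda>t::real. V (ereal x) (ereal t)) differentiable (at y) \<and>
        (\<lambda>s::real. deriv (\<lambda>t::real. V (ereal s) (ereal t)) y) differentiable (at x)) \<and>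
     continuous_on ({0<..} \<times> {0<..})
       (\<lambda>(x, y). deriv (\<lambda>s::real. deriv (\<lambda>t::real. V (ereal s) (ereal t)) y) x)"

section \<open>Inverted extreme value copulas and C-vines\<close>

definition inverted_ev_copula :: "(ereal \<Rightarrow> ereal \<Rightarrow> real) \<Rightarrow> real \<Rightarrow> real \<Rightarrow> real" where
  "inverted_ev_copula V u v =
     u + v - 1 + exp (- V (ereal (- 1 / ln (1 - u))) (ereal (- 1 / ln (1 - v))))"

definition inverted_ev_density :: "(ereal \<Rightarrow> ereal \<Rightarrow> real) \<Rightarrow> real \<Rightarrow> real \<Rightarrow> real" where
  "inverted_ev_density V u v = deriv (\<lambda>s. deriv (\<lambda>t. inverted_ev_copula V s t) v) u"

text \<open>\<^term>\<open>V k j\<close> is the exponent measure of the pair copula for the edge \<^emph>\<open>{k, j | 1, ..., k - 1}\<close>;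
  \<open>cvine_cdf V k j x\<close> is the conditional distribution function of the \<^term>\<open>j\<close>-th variable
  given the variables \<^emph>\<open>1, ..., k\<close>, for \<^prop>\<open>k < j\<close>.\<close>

primrec cvine_cdf ::
  "(nat \<Rightarrow> nat \<Rightarrow> ereal \<Rightarrow> ereal \<Rightarrow> real) \<Rightarrow> nat \<Rightarrow> nat \<Rightarrow> (nat \<Rightarrow> real) \<Rightarrow> real" where
  "cvine_cdf V 0 j x = 1 - exp (- x j)"
| "cvine_cdf V (Suc k) j x =
     deriv (\<lambda>u. inverted_ev_copula (V (Suc k) j) u (cvine_cdf V k j x)) (cvine_cdf V k (Suc k) x)"

definition cvine_density ::
  "(nat \<Rightarrow> nat \<Rightarrow> ereal \<Rightarrow> ereal \<Rightarrow> real) \<Rightarrow> nat set \<Rightarrow> (nat \<Rightarrow> real) \<Rightarrow> real" where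
  "cvine_density V C x =
     (if \<forall>i\<in>C. 0 < x i then
        (\<Prod>i\<in>C. exp (- x i)) *
        (\<Prod>(k, j)\<in>{(k, j). k \<in> C \<and> j \<in> C \<and> k < j}.
           inverted_ev_density (V k j) (cvine_cdf V (k - 1) k x) (cvine_cdf V (k - 1) j x))
      else 0)"

section \<open>Gauge functions\<close>

text \<open>Vectors indexed by \<^term>\<open>C\<close> are the functions in \<^term>\<open>PiE C (\<lambda>_. UNIV)\<close>. The densities
  live on the open orthant; the values of a gauge function on the boundary of the orthant are
  determined by continuity. Positivity of the density is required because \<^prop>\<open>ln 0 = (0::real)\<close>.\<close>

definition gauge_function ::
  "nat set \<Rightarrow> ((nat \<Rightarrow> real) \<Rightarrow> real) \<Rightarrow> ((nat \<Rightarrow> real) \<Rightarrow> real) \<Rightarrow> bool" where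
  "gauge_function C f g \<longleftrightarrow>
     continuous_on (PiE C (\<lambda>_. {0..})) g \<and>
     (\<forall>x\<in>PiE C (\<lambda>_. {0..}). \<forall>t>0. g (\<lambda>i\<in>C. t * x i) = t * g x) \<and>
     (\<forall>x\<in>PiE C (\<lambda>_. {0<..}).
        (\<forall>\<^sub>F t in at_top. 0 < f (\<lambda>i\<in>C. t * x i)) \<and>
        (\<lambda>t. - ln (f (\<lambda>i\<in>C. t * x i))) \<sim>[at_top] (\<lambda>t. t * g x))"

end

theory Submission
  imports Defs
begin

text \<open>
  Every quantity of the vine becomes transparent on the exponential scale. Write
  \<open>l(a, b) = V(1/a, 1/b)\<close> for the stable tail dependence function of a pair copula: it is
  homogeneous of order 1, so \<open>l(a, b) = b A(a/b)\<close> for a convex profile \<open>A\<close> of one variable, and the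
  partial derivatives of \<open>l\<close> are \<open>A'\<close> and \<open>D(r) = A(r) - r A'(r)\<close>, both evaluated at the ratio
  \<open>r = a/b\<close>. If the conditional distribution functions entering an edge are \<open>1 - exp(-a)\<close> and
  \<open>1 - exp(-b)\<close>, then the next conditional distribution function is again of the form
  \<open>1 - exp(-a')\<close> with \<open>a' = l(a, b) - a - ln A'(r)\<close>, and the edge contributes
  \<open>a + b - l(a, b) + ln (A'(r) D(r) + (a / b^2) A''(r))\<close> to \<open>ln f\<close>.

  Along a ray \<open>t x\<close> the rates \<open>a\<close> grow linearly in \<open>t\<close> while all logarithms stay bounded, since they
  depend on ratios that converge. Hence the rates divided by \<open>t\<close> converge to the limits obtained from
  the recursion \<open>a' = l(a, b) - a\<close>. In the limit of \<open>-ln f(t x) / t\<close> the contribution of an edge is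
  the difference of two consecutive limit rates of its second variable, so the sum over the edges
  telescopes: the gauge function is the sum over the variables \<open>j\<close> of the limit rate of \<open>j\<close> given all
  of its predecessors (\<open>subvine_limit\<close>). The same holds for the three sub-vines. So the two
  differences of gauge functions in the theorem are the limit rates of the variables \<open>d - 1\<close> and \<open>d\<close>
  given \<open>1, ..., d - 2\<close>, and the last edge turns them into the claimed value.

  Boundedness of the logarithms needs \<open>A' > 0\<close> and \<open>D > 0\<close> everywhere. This is forced by the
  positivity of \<open>f\<close> (\<open>edge_nondegenerate\<close>): both functions are monotone, so a zero of one of them
  makes the pair density vanish for all sufficiently extreme ratios \<open>a/b\<close>, and such ratios are
  attained because the rates are unbounded in their last variable.

  The argument identifies the gauge functions on the open orthant. On its boundary only
  continuity and homogeneity are at stake; they are inherited from the gauge functions of the sub-vines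
  and from \<open>l\<close>, which is Lipschitz continuous and homogeneous on the closed quadrant.
\<close>

section \<open>The stable tail dependence function of a spectral distribution\<close>

definition tail_dependence :: "real measure \<Rightarrow> real \<Rightarrow> real \<Rightarrow> real" where
  "tail_dependence H a b = 2 * (\<integral>w. max (w * a) ((1 - w) * b) \<partial>H)"

text \<open>The restriction of the tail dependence function to the line \<open>b = 1\<close>; with \<open>r = w / (1 - w)\<close> it is
  a rescaled Pickands dependence function. The slope of this profile is the first partial derivative
  of the tail dependence function, the intercept of its tangent line is the second one.\<close>

definition tail_profile :: "real measure \<Rightarrow> real \<Rightarrow> real" where
  "tail_profile H r = tail_dependence H r 1"

definition profile_slope :: "real measure \<Rightarrow> real \<Rightarrow> real" where
  "profile_slope H = deriv (tail_profile H)"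

definition profile_intercept :: "real measure \<Rightarrow> real \<Rightarrow> real" where
  "profile_intercept H r = tail_profile H r - r * profile_slope H r"

definition profile_curvature :: "real measure \<Rightarrow> real \<Rightarrow> real" where
  "profile_curvature H = deriv (profile_slope H)"

lemma ln_inverse_exp: "ln (1 / exp c) = - c" for c :: real
  by (simp add: ln_div)

lemma ln_over_t_limit:
  assumes "(\<phi> \<longlongrightarrow> c) at_top" "0 < c"
  shows "((\<lambda>t::real. ln (\<phi> t) / t) \<longlongrightarrow> 0) at_top"
  using tendsto_mult[OF tendsto_ln[OF assms(1)] tendsto_inverse_0_at_top[OF filterlim_ident]] assms(2)
  by (simp add: divide_inverse)

locale spectral =
  fixes H :: "real measure"
  assumes spectral: "spectral_distribution H"
begin

lemma AE_range: "AE w in H. 0 \<le> w \<and> w \<le> 1"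
  using spectral by (simp add: spectral_distribution_def)

lemma mean: "(\<integral>w. w \<partial>H) = 1 / 2"
  using spectral by (simp add: spectral_distribution_def)

sublocale real_distribution H
  using spectral by (simp add: spectral_distribution_def)

lemma integrable_id [simp]: "integrable H (\<lambda>w. w)"
  by (rule integrable_const_bound[where B = 1]) (use AE_range in auto)

lemma integrable_weighted_max [simp]: "integrable H (\<lambda>w. max (w * a) ((1 - w) * b))"
  by (intro integrable_max integrable_mult_left Bochner_Integration.integrable_diff) auto

lemma tail_dependence_mult:
  assumes "0 \<le> s"
  shows "tail_dependence H (s * a) (s * b) = s * tail_dependence H a b"
proof -
  have "max (w * (s * a)) ((1 - w) * (s * b)) = s * max (w * a) ((1 - w) * b)" for w
    using assms by (simp add: max_mult_distrib_left mult.left_commute)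
  then show ?thesis
    by (simp add: tail_dependence_def)
qed

lemma tail_dependence_profile:
  assumes "0 < b"
  shows "tail_dependence H a b = b * tail_profile H (a / b)"
  using tail_dependence_mult[of b "a / b" 1] assms by (simp add: tail_profile_def)

lemma tail_dependence_ge1: "a \<le> tail_dependence H a b"
proof -
  have "(\<integral>w. w * a \<partial>H) \<le> (\<integral>w. max (w * a) ((1 - w) * b) \<partial>H)"
    by (intro integral_mono) auto
  then show ?thesis
    by (simp add: tail_dependence_def mean)
qed

lemma tail_dependence_ge2: "b \<le> tail_dependence H a b"
proof -
  have "(\<integral>w. (1 - w) * b \<partial>H) \<le> (\<integral>w. max (w * a) ((1 - w) * b) \<partial>H)"
    by (intro integral_mono) auto
  then show ?thesis
    by (simp add: tail_dependence_def mean prob_space[unfolded space_eq_univ])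
qed

lemma tail_dependence_mono:
  assumes "a \<le> a'" "b \<le> b'"
  shows "tail_dependence H a b \<le> tail_dependence H a' b'"
proof -
  have "(\<integral>w. max (w * a) ((1 - w) * b) \<partial>H) \<le> (\<integral>w. max (w * a') ((1 - w) * b') \<partial>H)"
  proof (intro integral_mono_AE)
    show "AE w in H. max (w * a) ((1 - w) * b) \<le> max (w * a') ((1 - w) * b')"
      using AE_range by eventually_elim (intro max.mono mult_left_mono assms; simp)
  qed auto
  then show ?thesis
    by (simp add: tail_dependence_def)
qed

lemma tail_dependence_increment:
  assumes "a \<le> a'" "b \<le> b'"
  shows "tail_dependence H a' b' \<le> tail_dependence H a b + (a' - a) + (b' - b)"
proof -
  have "(\<integral>w. max (w * a') ((1 - w) * b') \<partial>H) \<le>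
      (\<integral>w. max (w * a) ((1 - w) * b) + (w * (a' - a) + (1 - w) * (b' - b)) \<partial>H)"
  proof (intro integral_mono_AE)
    show "AE w in H. max (w * a') ((1 - w) * b') \<le>
        max (w * a) ((1 - w) * b) + (w * (a' - a) + (1 - w) * (b' - b))"
      using AE_range
    proof eventually_elim
      case (elim w)
      then have "0 \<le> w * (a' - a)" "0 \<le> (1 - w) * (b' - b)"
        using assms by auto
      moreover have "w * a' = w * a + w * (a' - a)" "(1 - w) * b' = (1 - w) * b + (1 - w) * (b' - b)"
        by (simp_all add: algebra_simps)
      ultimately show ?case
        by linarith
    qed
  qed auto
  also have "\<dots> = (\<integral>w. max (w * a) ((1 - w) * b) \<partial>H) + ((a' - a) / 2 + (b' - b) / 2)"
    by (simp add: mean prob_space[unfolded space_eq_univ])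
  finally have *: "(\<integral>w. max (w * a') ((1 - w) * b') \<partial>H) \<le>
      (\<integral>w. max (w * a) ((1 - w) * b) \<partial>H) + ((a' - a) / 2 + (b' - b) / 2)" .
  have "X \<le> Y + (p / 2 + q / 2) \<Longrightarrow> 2 * X \<le> 2 * Y + p + q" for X Y p q :: real
    by simp
  from this[OF *] show ?thesis
    by (simp only: tail_dependence_def)
qed

lemma tail_dependence_lipschitz:
  "\<bar>tail_dependence H a b - tail_dependence H a' b'\<bar> \<le> \<bar>a - a'\<bar> + \<bar>b - b'\<bar>"
proof -
  define m n where "m = tail_dependence H (min a a') (min b b')"
    and "n = tail_dependence H (max a a') (max b b')"
  have "n \<le> m + (max a a' - min a a') + (max b b' - min b b')"
    unfolding m_def n_def by (rule tail_dependence_increment) auto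
  moreover have "m \<le> tail_dependence H a b" "m \<le> tail_dependence H a' b'"
    "tail_dependence H a b \<le> n" "tail_dependence H a' b' \<le> n"
    unfolding m_def n_def by (rule tail_dependence_mono; simp)+
  ultimately show ?thesis
    by linarith
qed

lemma tendsto_tail_dependence:
  assumes "(u \<longlongrightarrow> a) F" "(v \<longlongrightarrow> b) F"
  shows "((\<lambda>x. tail_dependence H (u x) (v x)) \<longlongrightarrow> tail_dependence H a b) F"
proof -
  have *: "((\<lambda>x. \<bar>u x - a\<bar> + \<bar>v x - b\<bar>) \<longlongrightarrow> 0) F"
    using assms by (auto intro!: tendsto_eq_intros)
  have "((\<lambda>x. tail_dependence H (u x) (v x) - tail_dependence H a b) \<longlongrightarrow> 0) F"
    by (rule tendsto_0_le[OF *, where K = 1])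
      (use tail_dependence_lipschitz in \<open>auto intro!: always_eventually\<close>)
  then show ?thesis
    by (simp add: LIM_zero_iff)
qed

lemma continuous_on_tail_dependence:
  assumes "continuous_on S u" "continuous_on S v"
  shows "continuous_on S (\<lambda>x. tail_dependence H (u x) (v x))"
  using assms by (auto simp: continuous_on_def intro: tendsto_tail_dependence)

text \<open>An average of maxima of affine functions of \<open>r\<close>.\<close>

lemma convex_on_tail_profile: "convex_on {0<..} (tail_profile H)"
proof (intro convex_onI)
  fix t x y :: real
  assume t: "0 < t" "t < 1"
  have "(\<integral>w. max (w * ((1 - t) * x + t * y)) (1 - w) \<partial>H) \<le>
      (\<integral>w. (1 - t) * max (w * x) ((1 - w) * 1) + t * max (w * y) ((1 - w) * 1) \<partial>H)"
  proof (intro integral_mono)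
    fix w :: real
    have "(1 - t) * (w * x) \<le> (1 - t) * max (w * x) (1 - w)" "t * (w * y) \<le> t * max (w * y) (1 - w)"
      "(1 - t) * (1 - w) \<le> (1 - t) * max (w * x) (1 - w)" "t * (1 - w) \<le> t * max (w * y) (1 - w)"
      using t by (auto intro!: mult_left_mono)
    moreover have "w * ((1 - t) * x + t * y) = (1 - t) * (w * x) + t * (w * y)"
      "1 - w = (1 - t) * (1 - w) + t * (1 - w)"
      by (simp_all add: algebra_simps)
    ultimately show "max (w * ((1 - t) * x + t * y)) (1 - w) \<le>
        (1 - t) * max (w * x) ((1 - w) * 1) + t * max (w * y) ((1 - w) * 1)"
      by simp
  qed (use integrable_weighted_max[of _ 1] in auto)
  then show "tail_profile H ((1 - t) *\<^sub>R x + t *\<^sub>R y) \<le> (1 - t) * tail_profile H x + t * tail_profile H y"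
    using integrable_weighted_max[of _ 1] by (simp add: tail_profile_def tail_dependence_def algebra_simps)
qed auto

lemma exponent_measure_tail:
  assumes "0 < a" "0 < b"
  shows "exponent_measure H (ereal (1 / a)) (ereal (1 / b)) = b * tail_profile H (a / b)"
  using exponent_measure_inverse[of a b H] assms
  by (simp add: tail_dependence_profile[symmetric] tail_dependence_def one_ereal_def)

end

section \<open>Smoothness and monotonicity of the profile\<close>

text \<open>Regularity of \<open>V\<close> as a function of two variables amounts, by homogeneity, to twice continuous
  differentiability of the profile.\<close>

locale regular_spectral = spectral +
  assumes regular: "regular_exponent (exponent_measure H)"
begin

abbreviation "V2_at_1 s \<equiv> deriv (\<lambda>t::real. exponent_measure H (ereal s) (ereal t)) 1"

lemma tail_profile_deriv:
  assumes "0 < r"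
  shows "(tail_profile H has_real_derivative profile_slope H r) (at r)"
proof -
  have "(\<lambda>s::real. exponent_measure H (ereal s) (ereal 1)) differentiable (at (1 / r))"
    using regular assms by (simp add: regular_exponent_def)
  moreover have "(\<lambda>r. 1 / r :: real) differentiable (at r)"
    using assms by simp
  ultimately have "((\<lambda>s::real. exponent_measure H (ereal s) (ereal 1)) \<circ> (\<lambda>r. 1 / r)) differentiable (at r)"
    by (rule differentiable_chain_at[rotated])
  then obtain D where "((\<lambda>r. exponent_measure H (ereal (1 / r)) (ereal 1)) has_real_derivative D) (at r)"
    by (auto simp: real_differentiable_def o_def)
  then have "(tail_profile H has_real_derivative D) (at r)"
    by (rule has_field_derivative_transform_within_open[where S = "{0<..}"])
      (use assms exponent_measure_tail[of _ 1] in auto)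
  then show ?thesis
    by (simp add: profile_slope_def DERIV_imp_deriv)
qed

lemma tail_profile_deriv' [derivative_intros]:
  assumes "(g has_real_derivative g') (at x within S)" "0 < g x"
  shows "((\<lambda>x. tail_profile H (g x)) has_real_derivative profile_slope H (g x) * g') (at x within S)"
  using DERIV_chain2[OF tail_profile_deriv assms(1)] assms(2) by simp

text \<open>Since \<open>V(s, t) = A(t/s) / t\<close>, the partial derivative \<open>V2(s, 1)\<close> contains \<open>A'(1/s)\<close>. Solving for
  it transfers the existence and continuity of \<open>V12\<close> to \<open>A''\<close>.\<close>

lemma V2_at_1_eq:
  assumes "0 < s"
  shows "V2_at_1 s = profile_slope H (1 / s) / s - tail_profile H (1 / s)"
proof (rule DERIV_imp_deriv)
  have "((\<lambda>t. (1 / t) * tail_profile H (t / s)) has_real_derivative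
      profile_slope H (1 / s) / s - tail_profile H (1 / s)) (at 1)"
    using assms by (auto intro!: derivative_eq_intros)
  then show "((\<lambda>t. exponent_measure H (ereal s) (ereal t)) has_real_derivative
      profile_slope H (1 / s) / s - tail_profile H (1 / s)) (at 1)"
    by (rule has_field_derivative_transform_within_open[where S = "{0<..}"])
      (use assms exponent_measure_tail[of "1 / s" "1 / _"] in auto)
qed

lemma V2_at_1_deriv:
  assumes "0 < s"
  shows "(V2_at_1 has_real_derivative deriv V2_at_1 s) (at s)"
  using regular assms by (auto simp: regular_exponent_def field_differentiable_def
      real_differentiable_def intro!: field_differentiable_derivI)

lemma profile_slope_V2:
  assumes "0 < r"
  shows "profile_slope H r = (V2_at_1 (1 / r) + tail_profile H r) / r"
  using assms by (simp add: V2_at_1_eq field_simps)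

lemma profile_slope_deriv:
  assumes "0 < r"
  shows "(profile_slope H has_real_derivative profile_curvature H r) (at r)"
proof -
  have chain: "((\<lambda>r. V2_at_1 (1 / r)) has_real_derivative deriv V2_at_1 (1 / r) * (- 1 / r\<^sup>2)) (at r)"
    by (rule DERIV_chain2[OF V2_at_1_deriv])
      (use assms in \<open>auto intro!: derivative_eq_intros simp: power2_eq_square\<close>)
  obtain D where "((\<lambda>r. (V2_at_1 (1 / r) + tail_profile H r) / r) has_real_derivative D) (at r)"
    using DERIV_divide[OF DERIV_add[OF chain tail_profile_deriv[OF assms]] DERIV_ident] assms by blast
  then have "(profile_slope H has_real_derivative D) (at r)"
    by (rule has_field_derivative_transform_within_open[where S = "{0<..}"])
      (use assms profile_slope_V2 in auto)
  then show ?thesis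
    by (simp add: profile_curvature_def DERIV_imp_deriv)
qed

lemma profile_slope_deriv' [derivative_intros]:
  assumes "(g has_real_derivative g') (at x within S)" "0 < g x"
  shows "((\<lambda>x. profile_slope H (g x)) has_real_derivative profile_curvature H (g x) * g') (at x within S)"
  using DERIV_chain2[OF profile_slope_deriv assms(1)] assms(2) by simp

lemma profile_curvature_V2:
  assumes "0 < r"
  shows "profile_curvature H r = - deriv V2_at_1 (1 / r) / r ^ 3"
proof -
  have "((\<lambda>s. profile_slope H (1 / s) / s - tail_profile H (1 / s)) has_real_derivative
      - profile_curvature H r * r ^ 3) (at (1 / r))"
    using assms by (auto intro!: derivative_eq_intros simp: field_simps power2_eq_square power3_eq_cube)
  then have "(V2_at_1 has_real_derivative - profile_curvature H r * r ^ 3) (at (1 / r))"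
    by (rule has_field_derivative_transform_within_open[where S = "{0<..}"])
      (use assms V2_at_1_eq in auto)
  then have "deriv V2_at_1 (1 / r) = - profile_curvature H r * r ^ 3"
    by (rule DERIV_imp_deriv)
  then show ?thesis
    using assms by simp
qed

lemma isCont_profile_curvature:
  assumes "0 < r"
  shows "isCont (profile_curvature H) r"
proof -
  have c: "continuous_on ({0<..} \<times> {0<..}) (\<lambda>p. deriv (\<lambda>s::real. deriv (\<lambda>t::real.
      exponent_measure H (ereal s) (ereal t)) (snd p)) (fst p))"
    using regular by (simp add: regular_exponent_def case_prod_beta)
  have "continuous_on {0<..} (\<lambda>r. deriv V2_at_1 (1 / r))"
    using continuous_on_compose2[OF c, of "{0<..}" "\<lambda>r. (1 / r, 1)"]
    by (force intro!: continuous_intros)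
  then have "continuous_on {0<..} (\<lambda>r. - deriv V2_at_1 (1 / r) / r ^ 3)"
    by (intro continuous_intros) auto
  then have "continuous_on {0<..} (profile_curvature H)"
    by (rule continuous_on_eq) (simp add: profile_curvature_V2)
  then show ?thesis
    using assms by (simp add: continuous_on_eq_continuous_at)
qed

lemma isCont_tail_profile: "0 < r \<Longrightarrow> isCont (tail_profile H) r"
  by (rule DERIV_isCont[OF tail_profile_deriv])

lemma isCont_profile_slope: "0 < r \<Longrightarrow> isCont (profile_slope H) r"
  by (rule DERIV_isCont[OF profile_slope_deriv])

lemma isCont_profile_intercept: "0 < r \<Longrightarrow> isCont (profile_intercept H) r"
  unfolding profile_intercept_def
  by (intro continuous_intros isCont_tail_profile isCont_profile_slope)

lemma profile_slope_mono:
  assumes "0 < r" "r \<le> s"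
  shows "profile_slope H r \<le> profile_slope H s"
proof (cases "r = s")
  case False
  have tangent: "tail_profile H y \<ge> tail_profile H x + profile_slope H x * (y - x)" if "0 < x" "0 < y" for x y
    using convex_on_imp_above_tangent[OF convex_on_tail_profile, where c = x and x = y and f' = "profile_slope H x"]
      that tail_profile_deriv[of x]
    by (auto simp: has_field_derivative_at_within interior_open algebra_simps)
  have "0 \<le> (profile_slope H s - profile_slope H r) * (s - r)"
    using tangent[of r s] tangent[of s r] assms by (simp add: algebra_simps)
  then show ?thesis
    using assms False by (simp add: zero_le_mult_iff)
qed simp

lemma profile_curvature_nonneg:
  assumes "0 < r"
  shows "0 \<le> profile_curvature H r"
proof (rule mono_on_imp_deriv_nonneg[OF _ profile_slope_deriv[OF assms]])
  show "mono_on {0<..} (profile_slope H)"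
    by (auto intro!: mono_onI profile_slope_mono)
qed (use assms in \<open>auto simp: interior_open\<close>)

lemma profile_slope_nonneg:
  assumes "0 < r"
  shows "0 \<le> profile_slope H r"
proof (rule mono_on_imp_deriv_nonneg[OF _ tail_profile_deriv[OF assms]])
  show "mono_on {0<..} (tail_profile H)"
    by (auto intro!: mono_onI tail_dependence_mono simp: tail_profile_def)
qed (use assms in \<open>auto simp: interior_open\<close>)

lemma profile_slope_le_1:
  assumes "0 < r"
  shows "profile_slope H r \<le> 1"
proof -
  have "((\<lambda>r. r - tail_profile H r) has_real_derivative 1 - profile_slope H r) (at r)"
    using assms by (auto intro!: derivative_eq_intros)
  moreover have "mono_on {0<..} (\<lambda>r. r - tail_profile H r)"
    using tail_dependence_increment[of _ _ 1 1]
    by (force intro!: mono_onI simp: tail_profile_def)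
  ultimately have "0 \<le> 1 - profile_slope H r"
    using assms by (intro mono_on_imp_deriv_nonneg[where A = "{0<..}"]) (auto simp: interior_open)
  then show ?thesis
    by simp
qed

text \<open>The intercept is the derivative in \<open>b\<close> of \<open>b A(r/b)\<close>, which is nondecreasing in \<open>b\<close>.\<close>

lemma profile_intercept_nonneg:
  assumes "0 < r"
  shows "0 \<le> profile_intercept H r"
proof (rule mono_on_imp_deriv_nonneg)
  show "((\<lambda>b. b * tail_profile H (r / b)) has_real_derivative profile_intercept H r) (at 1)"
    using assms by (auto intro!: derivative_eq_intros simp: profile_intercept_def)
  show "mono_on {0<..} (\<lambda>b. b * tail_profile H (r / b))"
    by (auto intro!: mono_onI tail_dependence_mono simp flip: tail_dependence_profile)
qed (auto simp: interior_open)

lemma profile_intercept_deriv: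
  assumes "0 < r"
  shows "(profile_intercept H has_real_derivative - r * profile_curvature H r) (at r)"
  unfolding profile_intercept_def using assms by (auto intro!: derivative_eq_intros)

lemma profile_intercept_antimono:
  assumes "0 < r" "r \<le> s"
  shows "profile_intercept H s \<le> profile_intercept H r"
proof (rule DERIV_nonpos_imp_nonincreasing[OF assms(2)])
  fix x assume "r \<le> x" "x \<le> s"
  then show "\<exists>y. (profile_intercept H has_real_derivative y) (at x) \<and> y \<le> 0"
    using assms profile_curvature_nonneg[of x] profile_intercept_deriv[of x] by fastforce
qed

text \<open>The slope is nonnegative and nondecreasing, so a zero propagates to all smaller ratios; symmetrically
  the intercept is nonnegative and nonincreasing, so a zero propagates to all larger ratios.\<close>

lemma slope_zero_below:
  assumes "profile_slope H r = 0" "0 < s" "s < r"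
  shows "profile_slope H s = 0" "profile_curvature H s = 0"
proof -
  have z: "profile_slope H q = 0" if "0 < q" "q \<le> r" for q
    using profile_slope_mono[OF that] profile_slope_nonneg[OF that(1)] assms(1) by simp
  show "profile_slope H s = 0"
    using z assms by simp
  have "((\<lambda>_. 0) has_real_derivative profile_curvature H s) (at s)"
    by (rule has_field_derivative_transform_within_open[OF profile_slope_deriv, where S = "{0<..<r}"])
      (use z assms in auto)
  then show "profile_curvature H s = 0"
    using DERIV_unique DERIV_const by blast
qed

lemma intercept_zero_above:
  assumes "profile_intercept H r = 0" "0 < r" "r < s"
  shows "profile_intercept H s = 0" "profile_curvature H s = 0"
proof -
  have z: "profile_intercept H q = 0" if "r \<le> q" for q
    using profile_intercept_antimono[OF assms(2) that] profile_intercept_nonneg[of q] assms(1,2) that by simp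
  show "profile_intercept H s = 0"
    using z assms by simp
  have "((\<lambda>_. 0) has_real_derivative - s * profile_curvature H s) (at s)"
    by (rule has_field_derivative_transform_within_open[OF profile_intercept_deriv, where S = "{r<..}"])
      (use z assms in auto)
  then have "- s * profile_curvature H s = 0"
    using DERIV_unique DERIV_const by blast
  then show "profile_curvature H s = 0"
    using assms by simp
qed

section \<open>Pair copulas on the exponential scale\<close>

lemma inverted_ev_copula_eq:
  assumes "0 < u" "u < 1" "0 < v" "v < 1"
  shows "inverted_ev_copula (exponent_measure H) u v =
    u + v - 1 + exp (- (- ln (1 - v) * tail_profile H (ln (1 - u) / ln (1 - v))))"
  using exponent_measure_tail[of "- ln (1 - u)" "- ln (1 - v)"] assms
  by (simp add: inverted_ev_copula_def)

lemma deriv_copula_1: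
  assumes "0 < a" "0 < b"
  shows "deriv (\<lambda>u. inverted_ev_copula (exponent_measure H) u (1 - exp (- b))) (1 - exp (- a)) =
    1 - profile_slope H (a / b) * exp (a - b * tail_profile H (a / b))"
proof (rule DERIV_imp_deriv)
  have "((\<lambda>u. u + (1 - exp (- b)) - 1 + exp (- (b * tail_profile H (- ln (1 - u) / b)))) has_real_derivative
      1 - profile_slope H (a / b) * exp (a - b * tail_profile H (a / b))) (at (1 - exp (- a)))"
    using assms by (auto intro!: derivative_eq_intros simp: exp_diff exp_minus ln_inverse_exp field_simps)
  then show "((\<lambda>u. inverted_ev_copula (exponent_measure H) u (1 - exp (- b))) has_real_derivative
      1 - profile_slope H (a / b) * exp (a - b * tail_profile H (a / b))) (at (1 - exp (- a)))"
    by (rule has_field_derivative_transform_within_open[where S = "{0<..<1}"])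
      (use assms in \<open>auto simp: inverted_ev_copula_eq\<close>)
qed

lemma deriv_copula_2:
  assumes "0 < a" "0 < b"
  shows "deriv (\<lambda>v. inverted_ev_copula (exponent_measure H) (1 - exp (- a)) v) (1 - exp (- b)) =
    1 - profile_intercept H (a / b) * exp (b - b * tail_profile H (a / b))"
proof (rule DERIV_imp_deriv)
  have "((\<lambda>v. (1 - exp (- a)) + v - 1 + exp (- (- ln (1 - v) * tail_profile H (- a / ln (1 - v))))) has_real_derivative
      1 - profile_intercept H (a / b) * exp (b - b * tail_profile H (a / b))) (at (1 - exp (- b)))"
    using assms by (auto intro!: derivative_eq_intros simp: exp_diff exp_minus ln_inverse_exp profile_intercept_def field_simps)
  then show "((\<lambda>v. inverted_ev_copula (exponent_measure H) (1 - exp (- a)) v) has_real_derivative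
      1 - profile_intercept H (a / b) * exp (b - b * tail_profile H (a / b))) (at (1 - exp (- b)))"
    by (rule has_field_derivative_transform_within_open[where S = "{0<..<1}"])
      (use assms in \<open>auto simp: inverted_ev_copula_eq\<close>)
qed

lemma inverted_ev_density_eq:
  assumes "0 < a" "0 < b"
  shows "inverted_ev_density (exponent_measure H) (1 - exp (- a)) (1 - exp (- b)) =
    exp (a + b - b * tail_profile H (a / b)) *
    (profile_slope H (a / b) * profile_intercept H (a / b) + a / b\<^sup>2 * profile_curvature H (a / b))"
    (is "_ = ?rhs")
  unfolding inverted_ev_density_def
proof (rule DERIV_imp_deriv)
  let ?c = "\<lambda>u. - ln (1 - u)"
  note [derivative_intros] = DERIV_chain2[OF profile_intercept_deriv]
  have "((\<lambda>u. 1 - profile_intercept H (?c u / b) * exp (b - b * tail_profile H (?c u / b)))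
      has_real_derivative ?rhs) (at (1 - exp (- a)))"
    using assms by (auto intro!: derivative_eq_intros simp: exp_diff exp_minus exp_add ln_inverse_exp field_simps power2_eq_square)
  then show "((\<lambda>s. deriv (\<lambda>t. inverted_ev_copula (exponent_measure H) s t) (1 - exp (- b)))
      has_real_derivative ?rhs) (at (1 - exp (- a)))"
  proof (rule has_field_derivative_transform_within_open[where S = "{0<..<1}"])
    fix u :: real assume "u \<in> {0<..<1}"
    then show "1 - profile_intercept H (?c u / b) * exp (b - b * tail_profile H (?c u / b)) =
        deriv (\<lambda>t. inverted_ev_copula (exponent_measure H) u t) (1 - exp (- b))"
      using deriv_copula_2[of "?c u" b] assms by simp
  qed (use assms in auto)
qed

text \<open>If \<open>A(r) = r\<close>, then \<open>A(s) - s\<close> has a minimum at \<open>r\<close>, whence \<open>A'(r) = 1\<close> and the tangent at \<open>r\<close> passes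
  through the origin.\<close>

lemma tail_dependence_gt1:
  assumes "0 < a" "0 < b" "0 < profile_intercept H (a / b)"
  shows "a < tail_dependence H a b"
proof -
  define r where "r = a / b"
  have "0 < r"
    using assms by (simp add: r_def)
  have "tail_profile H r \<noteq> r"
  proof
    assume eq: "tail_profile H r = r"
    have "profile_slope H r - 1 = 0"
    proof (rule DERIV_local_min)
      show "((\<lambda>s. tail_profile H s - s) has_real_derivative profile_slope H r - 1) (at r)"
        using \<open>0 < r\<close> by (auto intro!: derivative_eq_intros)
      show "\<forall>s. \<bar>r - s\<bar> < 1 \<longrightarrow> tail_profile H r - r \<le> tail_profile H s - s"
        using eq tail_dependence_ge1[of _ 1] by (simp add: tail_profile_def)
    qed simp
    then show False
      using assms(3) eq by (simp add: profile_intercept_def r_def)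
  qed
  then have "r < tail_profile H r"
    using tail_dependence_ge1[of r 1] by (simp add: tail_profile_def)
  then show ?thesis
    using assms by (simp add: tail_dependence_profile r_def field_simps)
qed

text \<open>The recursion for the rates: conditioning on the first variable maps the pair of rates \<open>(a, b)\<close> to
  the rate \<open>l(a, b) - a - ln A'(a/b)\<close>.\<close>

lemma deriv_copula_rate:
  assumes "0 < a" "0 < b" "0 < profile_slope H (a / b)"
  shows "deriv (\<lambda>u. inverted_ev_copula (exponent_measure H) u (1 - exp (- b))) (1 - exp (- a)) =
    1 - exp (- (tail_dependence H a b - a - ln (profile_slope H (a / b))))"
  using assms by (simp add: deriv_copula_1 tail_dependence_profile exp_add exp_diff)

context
  fixes a b :: "real \<Rightarrow> real" and \<alpha> \<beta> :: real
  assumes a: "((\<lambda>t. a t / t) \<longlongrightarrow> \<alpha>) at_top" and b: "((\<lambda>t. b t / t) \<longlongrightarrow> \<beta>) at_top"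
    and \<alpha>: "0 < \<alpha>" and \<beta>: "0 < \<beta>"
begin

lemma eventually_pos: "\<forall>\<^sub>F t in at_top. 0 < t \<and> 0 < a t \<and> 0 < b t"
  using order_tendstoD(1)[OF a \<alpha>] order_tendstoD(1)[OF b \<beta>] eventually_gt_at_top[of 0]
  by eventually_elim (auto simp: zero_less_divide_iff)

lemma tail_dependence_limit:
  "((\<lambda>t. tail_dependence H (a t) (b t) / t) \<longlongrightarrow> tail_dependence H \<alpha> \<beta>) at_top"
proof (rule Lim_transform_eventually[OF tendsto_tail_dependence[OF a b]])
  show "\<forall>\<^sub>F t in at_top. tail_dependence H (a t / t) (b t / t) = tail_dependence H (a t) (b t) / t"
    using eventually_gt_at_top[of 0]
  proof eventually_elim
    case (elim t)
    then show ?case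
      using tail_dependence_mult[of "1 / t" "a t" "b t"] by simp
  qed
qed

lemma ratio_limit: "((\<lambda>t. a t / b t) \<longlongrightarrow> \<alpha> / \<beta>) at_top"
proof (rule Lim_transform_eventually)
  show "((\<lambda>t. (a t / t) / (b t / t)) \<longlongrightarrow> \<alpha> / \<beta>) at_top"
    using \<beta> by (intro tendsto_divide a b) auto
  show "\<forall>\<^sub>F t in at_top. (a t / t) / (b t / t) = a t / b t"
    using eventually_pos by eventually_elim simp
qed

lemma rate_step_limit:
  assumes "0 < profile_slope H (\<alpha> / \<beta>)"
  shows "((\<lambda>t. (tail_dependence H (a t) (b t) - a t - ln (profile_slope H (a t / b t))) / t)
    \<longlongrightarrow> tail_dependence H \<alpha> \<beta> - \<alpha>) at_top"
proof -
  have "((\<lambda>t. profile_slope H (a t / b t)) \<longlongrightarrow> profile_slope H (\<alpha> / \<beta>)) at_top"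
    using isCont_tendsto_compose[OF isCont_profile_slope ratio_limit] \<alpha> \<beta> by simp
  from tendsto_diff[OF tendsto_diff[OF tail_dependence_limit a] ln_over_t_limit[OF this assms]]
  show ?thesis
    by (simp add: diff_divide_distrib)
qed

text \<open>The curvature term of the density carries a factor \<open>1 / b\<close> and disappears in the limit; what remains
  inside the logarithm converges to the positive product of slope and intercept.\<close>

lemma log_density_limit:
  assumes "0 < profile_slope H (\<alpha> / \<beta>)" "0 < profile_intercept H (\<alpha> / \<beta>)"
  defines "c \<equiv> \<lambda>t. inverted_ev_density (exponent_measure H) (1 - exp (- a t)) (1 - exp (- b t))"
  shows "\<forall>\<^sub>F t in at_top. 0 < c t"
    and "((\<lambda>t. ln (c t) / t) \<longlongrightarrow> \<alpha> + \<beta> - tail_dependence H \<alpha> \<beta>) at_top"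
proof -
  define P where "P t = profile_slope H (a t / b t) * profile_intercept H (a t / b t) +
      a t / (b t)\<^sup>2 * profile_curvature H (a t / b t)" for t
  define p where "p = profile_slope H (\<alpha> / \<beta>) * profile_intercept H (\<alpha> / \<beta>)"
  have "0 < \<alpha> / \<beta>"
    using \<alpha> \<beta> by simp
  note lim = isCont_tendsto_compose[OF _ ratio_limit]
  have "((\<lambda>t. inverse (b t / t) * inverse t) \<longlongrightarrow> inverse \<beta> * 0) at_top"
    using \<beta> by (intro tendsto_mult tendsto_inverse b tendsto_inverse_0_at_top filterlim_ident) auto
  moreover have "\<forall>\<^sub>F t in at_top. inverse (b t / t) * inverse t = 1 / b t"
    using eventually_gt_at_top[of 0] by eventually_elim (simp add: field_simps)
  ultimately have "((\<lambda>t. 1 / b t) \<longlongrightarrow> 0) at_top"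
    by (auto intro: Lim_transform_eventually)
  with ratio_limit have "((\<lambda>t. a t / b t * (1 / b t)) \<longlongrightarrow> \<alpha> / \<beta> * 0) at_top"
    by (intro tendsto_mult)
  then have "((\<lambda>t. a t / (b t)\<^sup>2) \<longlongrightarrow> 0) at_top"
    by (simp add: power2_eq_square)
  then have "(P \<longlongrightarrow> p + 0 * profile_curvature H (\<alpha> / \<beta>)) at_top"
    unfolding P_def p_def using \<open>0 < \<alpha> / \<beta>\<close>
    by (intro tendsto_add tendsto_mult lim isCont_profile_slope isCont_profile_intercept
        isCont_profile_curvature) auto
  then have P: "(P \<longlongrightarrow> p) at_top"
    by simp
  have p: "0 < p"
    using assms by (simp add: p_def)
  note P_pos = order_tendstoD(1)[OF P p]
  have c_eq: "c t = exp (a t + b t - tail_dependence H (a t) (b t)) * P t" if "0 < a t" "0 < b t" for t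
    using that by (simp add: c_def P_def inverted_ev_density_eq tail_dependence_profile)
  show "\<forall>\<^sub>F t in at_top. 0 < c t"
    using eventually_pos P_pos by eventually_elim (simp add: c_eq)
  have "((\<lambda>t. a t / t + b t / t - tail_dependence H (a t) (b t) / t + ln (P t) / t) \<longlongrightarrow>
      \<alpha> + \<beta> - tail_dependence H \<alpha> \<beta> + 0) at_top"
    by (intro tendsto_add tendsto_diff a b tail_dependence_limit ln_over_t_limit[OF P p])
  moreover have "\<forall>\<^sub>F t in at_top. a t / t + b t / t - tail_dependence H (a t) (b t) / t + ln (P t) / t = ln (c t) / t"
    using eventually_pos P_pos
    by eventually_elim (simp add: c_eq ln_mult add_divide_distrib diff_divide_distrib)
  ultimately show "((\<lambda>t. ln (c t) / t) \<longlongrightarrow> \<alpha> + \<beta> - tail_dependence H \<alpha> \<beta>) at_top"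
    by (auto intro: Lim_transform_eventually)
qed

end

end

section \<open>Rates of a vine and their limits\<close>

text \<open>\<open>vine_rate H k j x\<close> is \<open>-ln (1 - F)\<close> for the conditional distribution function \<open>F\<close> of the \<open>j\<close>-th
  variable given the variables \<open>1, ..., k\<close> (see \<open>cvine_cdf_rate\<close> below); \<open>vine_gauge\<close> is its
  growth rate along rays, where the logarithmic term is lost.\<close>

primrec vine_rate :: "(nat \<Rightarrow> nat \<Rightarrow> real measure) \<Rightarrow> nat \<Rightarrow> nat \<Rightarrow> (nat \<Rightarrow> real) \<Rightarrow> real" where
  "vine_rate H 0 j x = x j"
| "vine_rate H (Suc k) j x =
     tail_dependence (H (Suc k) j) (vine_rate H k (Suc k) x) (vine_rate H k j x) - vine_rate H k (Suc k) x -
     ln (profile_slope (H (Suc k) j) (vine_rate H k (Suc k) x / vine_rate H k j x))"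

primrec vine_gauge :: "(nat \<Rightarrow> nat \<Rightarrow> real measure) \<Rightarrow> nat \<Rightarrow> nat \<Rightarrow> (nat \<Rightarrow> real) \<Rightarrow> real" where
  "vine_gauge H 0 j x = x j"
| "vine_gauge H (Suc k) j x =
     tail_dependence (H (Suc k) j) (vine_gauge H k (Suc k) x) (vine_gauge H k j x) - vine_gauge H k (Suc k) x"

definition nondegenerate :: "real measure \<Rightarrow> bool" where
  "nondegenerate H \<longleftrightarrow> (\<forall>r>0. 0 < profile_slope H r \<and> 0 < profile_intercept H r)"

lemma vine_rate_cong:
  assumes "\<And>i. i \<in> {1..k} \<Longrightarrow> x i = y i" "x j = y j"
  shows "vine_rate H k j x = vine_rate H k j y"
  using assms
proof (induction k arbitrary: j)
  case (Suc k)
  have "vine_rate H k j x = vine_rate H k j y" "vine_rate H k (Suc k) x = vine_rate H k (Suc k) y"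
    by (rule Suc.IH; use Suc.prems in simp)+
  then show ?case
    by simp
qed simp

lemma sum_telescope_from_1:
  fixes f :: "nat \<Rightarrow> real"
  shows "(\<Sum>k\<in>{1..n}. f (k - 1) - f k) = f 0 - f n"
  by (induction n) auto

lemma finite_pairs [simp]:
  assumes "finite C"
  shows "finite {(k, j). k \<in> C \<and> j \<in> C \<and> k < (j::nat)}"
  by (rule finite_subset[of _ "C \<times> C"]) (use assms in auto)

locale ev_vine =
  fixes d :: nat and H :: "nat \<Rightarrow> nat \<Rightarrow> real measure" and V :: "nat \<Rightarrow> nat \<Rightarrow> ereal \<Rightarrow> ereal \<Rightarrow> real"
  assumes edge: "1 \<le> k \<Longrightarrow> k < j \<Longrightarrow> j \<le> d \<Longrightarrow> regular_spectral (H k j)"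
    and V: "1 \<le> k \<Longrightarrow> k < j \<Longrightarrow> j \<le> d \<Longrightarrow> V k j = exponent_measure (H k j)"
begin

lemma cvine_cdf_rate:
  assumes "\<And>k' j'. k' \<in> {1..k} \<Longrightarrow> k' < j' \<Longrightarrow> j' \<le> d \<Longrightarrow> nondegenerate (H k' j')"
    and "k < j" "j \<le> d" and "\<And>i. i \<in> {1..k} \<Longrightarrow> 0 < x i" "0 < x j"
  shows "0 < vine_rate H k j x \<and> cvine_cdf V k j x = 1 - exp (- vine_rate H k j x)"
  using assms
proof (induction k arbitrary: j)
  case (Suc k)
  define a b where "a = vine_rate H k (Suc k) x" and "b = vine_rate H k j x"
  interpret regular_spectral "H (Suc k) j"
    using Suc.prems by (intro edge) auto
  have a: "0 < a \<and> cvine_cdf V k (Suc k) x = 1 - exp (- a)"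
    unfolding a_def by (rule Suc.IH) (use Suc.prems in auto)
  have b: "0 < b \<and> cvine_cdf V k j x = 1 - exp (- b)"
    unfolding b_def by (rule Suc.IH) (use Suc.prems in auto)
  have "nondegenerate (H (Suc k) j)"
    using Suc.prems by auto
  then have pos: "0 < profile_slope (H (Suc k) j) (a / b)" "0 < profile_intercept (H (Suc k) j) (a / b)"
    using a b by (auto simp: nondegenerate_def)
  have rate: "vine_rate H (Suc k) j x =
      tail_dependence (H (Suc k) j) a b - a - ln (profile_slope (H (Suc k) j) (a / b))"
    by (simp add: a_def b_def)
  have "ln (profile_slope (H (Suc k) j) (a / b)) \<le> 0"
    using pos a b profile_slope_le_1[of "a / b"] by simp
  moreover have "a < tail_dependence (H (Suc k) j) a b"
    using a b pos by (intro tail_dependence_gt1) auto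
  ultimately have "0 < vine_rate H (Suc k) j x"
    unfolding rate by linarith
  moreover have "cvine_cdf V (Suc k) j x = 1 - exp (- vine_rate H (Suc k) j x)"
    using deriv_copula_rate[of a b] a b pos V[of "Suc k" j] Suc.prems(2,3) unfolding rate by simp
  ultimately show ?case
    by simp
qed simp

text \<open>One conditioning step lowers the rate of \<open>j\<close> at most by the rate of the conditioning variable, because
  \<open>l(a, b) \<ge> b\<close> and \<open>ln A' \<le> 0\<close>; the rate of the conditioning variable does not depend on \<open>x j\<close>.\<close>

lemma vine_rate_unbounded:
  assumes "\<And>k' j'. k' \<in> {1..k} \<Longrightarrow> k' < j' \<Longrightarrow> j' \<le> d \<Longrightarrow> nondegenerate (H k' j')"
    and "k < j" "j \<le> d" and "\<And>i. i \<in> {1..k} \<Longrightarrow> 0 < x i"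
  shows "filterlim (\<lambda>s. vine_rate H k j (x(j := s))) at_top at_top"
  using assms
proof (induction k arbitrary: j)
  case 0
  show ?case
    by (simp add: filterlim_ident)
next
  case (Suc k)
  interpret regular_spectral "H (Suc k) j"
    using Suc.prems by (intro edge) auto
  have "filterlim (\<lambda>s. vine_rate H k j (x(j := s))) at_top at_top"
    by (rule Suc.IH) (use Suc.prems in auto)
  then have lim: "filterlim (\<lambda>s. - vine_rate H k (Suc k) x + vine_rate H k j (x(j := s))) at_top at_top"
    by (intro filterlim_tendsto_add_at_top[OF tendsto_const])
  show ?case
  proof (rule filterlim_at_top_mono[OF lim])
    show "\<forall>\<^sub>F s in at_top. - vine_rate H k (Suc k) x + vine_rate H k j (x(j := s)) \<le>
        vine_rate H (Suc k) j (x(j := s))"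
      using eventually_gt_at_top[of 0]
    proof eventually_elim
      case (elim s)
      define a b where "a = vine_rate H k (Suc k) (x(j := s))" and "b = vine_rate H k j (x(j := s))"
      have a: "a = vine_rate H k (Suc k) x"
        unfolding a_def by (rule vine_rate_cong) (use Suc.prems in auto)
      have "0 < a" "0 < b"
        unfolding a_def b_def
        by (rule cvine_cdf_rate[THEN conjunct1]; use Suc.prems elim in auto)+
      moreover have "nondegenerate (H (Suc k) j)"
        using Suc.prems by auto
      ultimately have "0 < profile_slope (H (Suc k) j) (a / b)"
        by (auto simp: nondegenerate_def)
      then have "ln (profile_slope (H (Suc k) j) (a / b)) \<le> 0"
        using profile_slope_le_1[of "a / b"] \<open>0 < a\<close> \<open>0 < b\<close> by simp
      moreover have "b \<le> tail_dependence (H (Suc k) j) a b"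
        by (rule tail_dependence_ge2)
      moreover have "vine_rate H (Suc k) j (x(j := s)) =
          tail_dependence (H (Suc k) j) a b - a - ln (profile_slope (H (Suc k) j) (a / b))"
        by (simp add: a_def b_def)
      ultimately show ?case
        using a unfolding b_def by linarith
    qed
  qed
qed

text \<open>By induction on the depth \<open>k\<close> of the edge. Nondegeneracy of the edges at smaller depth makes the
  rates entering the edge \<open>(k, j)\<close> positive, and unbounded in \<open>x k\<close> and in \<open>x j\<close> separately. Their
  ratio therefore takes arbitrarily small and arbitrarily large values, at which a zero of the
  slope or of the intercept would annihilate the density.\<close>

lemma edge_nondegenerate:
  assumes pos: "\<And>x. (\<forall>i\<in>{1..d}. 0 < x i) \<Longrightarrow> 0 < cvine_density V {1..d} x"
    and "1 \<le> k" "k < j" "j \<le> d"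
  shows "nondegenerate (H k j)"
  using assms(2-)
proof (induction k arbitrary: j rule: less_induct)
  case (less k)
  interpret regular_spectral "H k j"
    using less.prems by (intro edge) auto
  obtain m where k: "k = Suc m"
    using less.prems(1) by (cases k) auto
  have IH: "nondegenerate (H k' j')" if "k' \<in> {1..m}" "k' < j'" "j' \<le> d" for k' j'
    using less.IH[of k' j'] that by (auto simp: k)
  have rates: "0 < vine_rate H m k x" "0 < vine_rate H m j x"
    "cvine_cdf V m k x = 1 - exp (- vine_rate H m k x)"
    "cvine_cdf V m j x = 1 - exp (- vine_rate H m j x)"
    if "\<forall>i\<in>{1..d}. 0 < x i" for x
    using cvine_cdf_rate[OF IH, where j = k and x = x] cvine_cdf_rate[OF IH, where j = j and x = x] that less.prems by (auto simp: k)
  \<comment> \<open>positivity of the whole density makes the factor of the edge nonzero\<close>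
  have factor: "profile_slope (H k j) r * profile_intercept (H k j) r \<noteq> 0 \<or> profile_curvature (H k j) r \<noteq> 0"
    if x: "\<forall>i\<in>{1..d}. 0 < x i" and r: "r = vine_rate H m k x / vine_rate H m j x" for x r
  proof -
    have "(\<Prod>(k, j)\<in>{(k, j). k \<in> {1..d} \<and> j \<in> {1..d} \<and> k < j}.
        inverted_ev_density (V k j) (cvine_cdf V (k - 1) k x) (cvine_cdf V (k - 1) j x)) \<noteq> 0"
      using pos[OF x] x by (auto simp: cvine_density_def)
    moreover have "finite {(k, j). k \<in> {1..d} \<and> j \<in> {1..d} \<and> k < j}"
      by (rule finite_pairs) simp
    moreover have "(k, j) \<in> {(k, j). k \<in> {1..d} \<and> j \<in> {1..d} \<and> k < j}"
      using less.prems by simp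
    ultimately have "(case (k, j) of (k, j) \<Rightarrow>
        inverted_ev_density (V k j) (cvine_cdf V (k - 1) k x) (cvine_cdf V (k - 1) j x)) \<noteq> 0"
      by (metis (no_types, lifting) prod_zero_iff)
    moreover have "k - 1 = m"
      by (simp add: k)
    ultimately have "inverted_ev_density (exponent_measure (H k j))
        (1 - exp (- vine_rate H m k x)) (1 - exp (- vine_rate H m j x)) \<noteq> 0"
      using rates[OF x] V[of k j] less.prems by simp
    then show ?thesis
      using rates[OF x] r by (auto simp: inverted_ev_density_eq)
  qed
  have "profile_slope (H k j) r \<noteq> 0" if r: "0 < r" for r
  proof
    assume 0: "profile_slope (H k j) r = 0"
    \<comment> \<open>a large \<open>x j\<close> gives a small ratio of the rates\<close>
    define x where "x s = (\<lambda>_. 1 :: real)(j := s)" for s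
    define a where "a = vine_rate H m k (\<lambda>_. 1)"
    have a: "vine_rate H m k (x s) = a" for s
      unfolding a_def x_def by (rule vine_rate_cong) (use less.prems k in auto)
    have "filterlim (\<lambda>s. vine_rate H m j (x s)) at_top at_top"
      unfolding x_def by (rule vine_rate_unbounded[OF IH]) (use less.prems k in auto)
    then have "\<forall>\<^sub>F s in at_top. a / r < vine_rate H m j (x s) \<and> 0 < s"
      by (intro eventually_conj eventually_gt_at_top) (simp add: filterlim_at_top_dense)
    then obtain s where s: "a / r < vine_rate H m j (x s)" "0 < s"
      using eventually_happens by fastforce
    then have x: "\<forall>i\<in>{1..d}. 0 < x s i"
      by (simp add: x_def)
    have "0 < a / vine_rate H m j (x s)" "a / vine_rate H m j (x s) < r"
      using rates(1,2)[OF x] s r by (simp_all add: a field_simps)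
    then show False
      using factor[OF x] slope_zero_below[OF 0] by (auto simp: a)
  qed
  moreover have "profile_intercept (H k j) r \<noteq> 0" if r: "0 < r" for r
  proof
    assume 0: "profile_intercept (H k j) r = 0"
    \<comment> \<open>a large \<open>x k\<close> gives a large ratio of the rates\<close>
    define x where "x s = (\<lambda>_. 1 :: real)(k := s)" for s
    define b where "b = vine_rate H m j (\<lambda>_. 1)"
    have b: "vine_rate H m j (x s) = b" for s
      unfolding b_def x_def by (rule vine_rate_cong) (use less.prems k in auto)
    have "filterlim (\<lambda>s. vine_rate H m k (x s)) at_top at_top"
      unfolding x_def by (rule vine_rate_unbounded[OF IH]) (use less.prems k in auto)
    then have "\<forall>\<^sub>F s in at_top. r * b < vine_rate H m k (x s) \<and> 0 < s"
      by (intro eventually_conj eventually_gt_at_top) (simp add: filterlim_at_top_dense)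
    then obtain s where s: "r * b < vine_rate H m k (x s)" "0 < s"
      using eventually_happens by fastforce
    then have x: "\<forall>i\<in>{1..d}. 0 < x s i"
      by (simp add: x_def)
    have "r < vine_rate H m k (x s) / b"
      using rates(1,2)[OF x] s r by (simp add: b field_simps)
    then show False
      using factor[OF x] intercept_zero_above[OF 0 r] by (auto simp: b)
  qed
  ultimately show ?case
    using profile_slope_nonneg profile_intercept_nonneg by (fastforce simp: nondegenerate_def)
qed

end

section \<open>Limits along rays and the gauge of a sub-vine\<close>

locale nondegenerate_vine = ev_vine +
  assumes nondeg: "1 \<le> k \<Longrightarrow> k < j \<Longrightarrow> j \<le> d \<Longrightarrow> nondegenerate (H k j)"
begin

lemma vine_gauge_pos:
  assumes "k < j" "j \<le> d" "\<And>i. i \<in> {1..k} \<Longrightarrow> 0 < x i" "0 < x j"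
  shows "0 < vine_gauge H k j x"
  using assms
proof (induction k arbitrary: j)
  case (Suc k)
  interpret regular_spectral "H (Suc k) j"
    using Suc.prems by (intro edge) auto
  have "0 < vine_gauge H k (Suc k) x" "0 < vine_gauge H k j x"
    by (rule Suc.IH; use Suc.prems in auto)+
  then show ?case
    using tail_dependence_gt1 nondeg[of "Suc k" j] Suc.prems by (simp add: nondegenerate_def)
qed simp

text \<open>The vectors \<open>y t\<close> need to follow the ray only in the coordinates on which the rate depends, so
  that the result applies to vectors that are undefined outside a sub-vine.\<close>

lemma vine_rate_limit:
  assumes "k < j" "j \<le> d" "\<And>i. i \<in> {1..k} \<union> {j} \<Longrightarrow> 0 < x i"
    and "\<And>i. i \<in> {1..k} \<union> {j} \<Longrightarrow> ((\<lambda>t. y t i / t) \<longlongrightarrow> x i) at_top"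
  shows "((\<lambda>t. vine_rate H k j (y t) / t) \<longlongrightarrow> vine_gauge H k j x) at_top"
  using assms
proof (induction k arbitrary: j)
  case (Suc k)
  interpret regular_spectral "H (Suc k) j"
    using Suc.prems by (intro edge) auto
  have lim: "((\<lambda>t. vine_rate H k (Suc k) (y t) / t) \<longlongrightarrow> vine_gauge H k (Suc k) x) at_top"
    "((\<lambda>t. vine_rate H k j (y t) / t) \<longlongrightarrow> vine_gauge H k j x) at_top"
    by (rule Suc.IH; use Suc.prems in auto)+
  have pos: "0 < vine_gauge H k (Suc k) x" "0 < vine_gauge H k j x"
    by (rule vine_gauge_pos; use Suc.prems in auto)+
  show ?case
    using rate_step_limit[OF lim pos] nondeg[of "Suc k" j] Suc.prems(1,2) pos
    by (simp add: nondegenerate_def)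
qed simp

text \<open>By the recursion for the limit rates, the limit \<open>\<alpha> + \<beta> - l(\<alpha>, \<beta>)\<close> is a
  difference of consecutive limit rates of \<open>j\<close>.\<close>

lemma pair_density_limit:
  assumes k: "k = Suc m" and "k < j" "j \<le> d" and x: "\<And>i. i \<in> {1..k} \<union> {j} \<Longrightarrow> 0 < x i"
    and y: "\<And>t i. i \<in> {1..k} \<union> {j} \<Longrightarrow> y t i = t * x i"
  defines "c \<equiv> \<lambda>t. inverted_ev_density (V k j) (cvine_cdf V m k (y t)) (cvine_cdf V m j (y t))"
  shows "\<forall>\<^sub>F t in at_top. 0 < c t"
    and "((\<lambda>t. ln (c t) / t) \<longlongrightarrow> vine_gauge H m j x - vine_gauge H k j x) at_top"
proof -
  interpret regular_spectral "H k j"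
    using assms by (intro edge) auto
  define a b where "a t = vine_rate H m k (y t)" and "b t = vine_rate H m j (y t)" for t
  define c' where "c' t = inverted_ev_density (exponent_measure (H k j)) (1 - exp (- a t)) (1 - exp (- b t))" for t
  define \<alpha> \<beta> where "\<alpha> = vine_gauge H m k x" and "\<beta> = vine_gauge H m j x"
  have yx: "((\<lambda>t. y t i / t) \<longlongrightarrow> x i) at_top" if "i \<in> {1..k} \<union> {j}" for i
  proof (rule Lim_transform_eventually[OF tendsto_const])
    show "\<forall>\<^sub>F t in at_top. x i = y t i / t"
      using eventually_gt_at_top[of 0] by eventually_elim (simp add: y[OF that])
  qed
  have lim: "((\<lambda>t. a t / t) \<longlongrightarrow> \<alpha>) at_top" "((\<lambda>t. b t / t) \<longlongrightarrow> \<beta>) at_top"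
    unfolding a_def b_def \<alpha>_def \<beta>_def by (rule vine_rate_limit; use k assms(2,3) x yx in auto)+
  have pos: "0 < \<alpha>" "0 < \<beta>"
    unfolding \<alpha>_def \<beta>_def by (rule vine_gauge_pos; use k assms(2,3) x in auto)+
  have slopes: "0 < profile_slope (H k j) (\<alpha> / \<beta>)" "0 < profile_intercept (H k j) (\<alpha> / \<beta>)"
    using nondeg[of k j] pos assms(1-3) by (auto simp: nondegenerate_def)
  note L = log_density_limit[OF lim pos slopes, folded c'_def]
  have c: "\<forall>\<^sub>F t in at_top. c' t = c t"
    using eventually_gt_at_top[of 0]
  proof eventually_elim
    case (elim t)
    then have "0 < y t i" if "i \<in> {1..k} \<union> {j}" for i
      using x y that by simp
    then have "cvine_cdf V m k (y t) = 1 - exp (- a t)" "cvine_cdf V m j (y t) = 1 - exp (- b t)"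
      unfolding a_def b_def
      by (intro cvine_cdf_rate[THEN conjunct2]; use assms(1-3) nondeg in \<open>auto simp del: cvine_cdf.simps\<close>)+
    then show ?case
      using assms(1-3) by (simp add: c_def c'_def V)
  qed
  show "\<forall>\<^sub>F t in at_top. 0 < c t"
    using L(1) c by eventually_elim simp
  have "\<alpha> + \<beta> - tail_dependence (H k j) \<alpha> \<beta> = vine_gauge H m j x - vine_gauge H k j x"
    unfolding \<alpha>_def \<beta>_def k by simp
  moreover have "((\<lambda>t. ln (c t) / t) \<longlongrightarrow> \<alpha> + \<beta> - tail_dependence (H k j) \<alpha> \<beta>) at_top"
    by (rule Lim_transform_eventually[OF L(2)]) (use c in eventually_elim, simp)
  ultimately show "((\<lambda>t. ln (c t) / t) \<longlongrightarrow> vine_gauge H m j x - vine_gauge H k j x) at_top"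
    by simp
qed

text \<open>The condition on \<open>p\<close> says that the elements of \<open>C\<close> below any \<open>j\<close> in \<open>C\<close> have no gap. It holds
  for the full vine and for the sub-vines obtained by dropping \<open>d\<close>, \<open>d - 1\<close> or both, where only the
  last element can follow a gap; it makes the conditioning sets of all edges within \<open>C\<close> subsets
  of \<open>C\<close>, and the sum of the edge contributions telescopes in the first index.\<close>

lemma subvine_limit:
  assumes C: "C \<subseteq> {1..d}" and p: "\<And>j. j \<in> C \<Longrightarrow> {k \<in> C. k < j} = {1..p j}"
    and x: "\<And>i. i \<in> C \<Longrightarrow> 0 < x i"
  defines "f \<equiv> \<lambda>t. cvine_density V C (\<lambda>i\<in>C. t * x i)"
  shows "((\<lambda>t. - ln (f t) / t) \<longlongrightarrow> (\<Sum>j\<in>C. vine_gauge H (p j) j x)) at_top"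
proof -
  define y where "y t = (\<lambda>i\<in>C. t * x i)" for t
  define P where "P = {(k, j). k \<in> C \<and> j \<in> C \<and> k < j}"
  define c where "c = (\<lambda>(k, j) t. inverted_ev_density (V k j) (cvine_cdf V (k - 1) k (y t)) (cvine_cdf V (k - 1) j (y t)))"
  define G where "G = (\<lambda>(k, j). vine_gauge H (k - 1) j x - vine_gauge H k j x)"
  have fin: "finite C"
    using C finite_subset by blast
  then have finP: "finite P"
    by (simp add: P_def)
  have "(\<forall>\<^sub>F t in at_top. 0 < c e t) \<and> ((\<lambda>t. ln (c e t) / t) \<longlongrightarrow> G e) at_top" if e_in: "e \<in> P" for e
  proof -
    obtain k j where e: "e = (k, j)" and kj: "k \<in> C" "j \<in> C" "k < j"
      using e_in by (auto simp: P_def)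
    have "k \<in> {k \<in> C. k < j}"
      using kj by simp
    then have "k \<in> {1..p j}"
      unfolding p[OF kj(2)] .
    \<comment> \<open>all variables on which the edge depends belong to \<open>C\<close>\<close>
    then have "{1..k} \<subseteq> {k \<in> C. k < j}"
      unfolding p[OF kj(2)] by auto
    then have sub: "i \<in> C" if "i \<in> {1..k} \<union> {j}" for i
      using kj that by auto
    have "1 \<le> k" "j \<le> d"
      using C kj by auto
    then show ?thesis
      unfolding e c_def G_def prod.case
      using pair_density_limit[of k "k - 1" j x y] kj(3) sub x by (auto simp: y_def)
  qed
  then have c_pos: "\<forall>\<^sub>F t in at_top. \<forall>e\<in>P. 0 < c e t"
    and c_lim: "\<And>e. e \<in> P \<Longrightarrow> ((\<lambda>t. ln (c e t) / t) \<longlongrightarrow> G e) at_top"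
    using finP by (auto simp: eventually_ball_finite_distrib)
  have f_eq: "f t = (\<Prod>i\<in>C. exp (- (t * x i))) * (\<Prod>e\<in>P. c e t)" if "0 < t" for t
    using that x by (simp add: f_def cvine_density_def P_def c_def y_def case_prod_beta)
  have "(\<Sum>e\<in>P. G e) = (\<Sum>(j, k)\<in>Sigma C (\<lambda>j. {k \<in> C. k < j}). G (k, j))"
    by (rule sum.reindex_bij_witness[of _ "\<lambda>(j, k). (k, j)" "\<lambda>(k, j). (j, k)"]) (auto simp: P_def)
  also have "\<dots> = (\<Sum>j\<in>C. \<Sum>k\<in>{k \<in> C. k < j}. G (k, j))"
    using fin by (simp add: sum.Sigma)
  also have "\<dots> = (\<Sum>j\<in>C. x j - vine_gauge H (p j) j x)"
    using sum_telescope_from_1[of "\<lambda>k. vine_gauge H k _ x"]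
    by (intro sum.cong refl) (simp add: p G_def)
  finally have G: "(\<Sum>e\<in>P. G e) = (\<Sum>j\<in>C. x j) - (\<Sum>j\<in>C. vine_gauge H (p j) j x)"
    by (simp add: sum_subtractf)
  have "((\<lambda>t. (\<Sum>i\<in>C. x i) - (\<Sum>e\<in>P. ln (c e t) / t)) \<longlongrightarrow> (\<Sum>i\<in>C. x i) - (\<Sum>e\<in>P. G e)) at_top"
    by (intro tendsto_diff tendsto_const tendsto_sum c_lim)
  moreover have "\<forall>\<^sub>F t in at_top. (\<Sum>i\<in>C. x i) - (\<Sum>e\<in>P. ln (c e t) / t) = - ln (f t) / t"
    using c_pos eventually_gt_at_top[of 0]
  proof eventually_elim
    case (elim t)
    have "ln (f t) = - t * (\<Sum>i\<in>C. x i) + (\<Sum>e\<in>P. ln (c e t))"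
    proof -
      have pos: "0 < (\<Prod>e\<in>P. c e t)"
        using elim by (simp add: prod_pos)
      have "f t = exp (- t * (\<Sum>i\<in>C. x i)) * (\<Prod>e\<in>P. c e t)"
        using elim fin by (simp add: f_eq sum_distrib_left flip: exp_sum sum_negf)
      then have "ln (f t) = - t * (\<Sum>i\<in>C. x i) + ln (\<Prod>e\<in>P. c e t)"
        using pos by (simp add: ln_mult)
      also have "ln (\<Prod>e\<in>P. c e t) = (\<Sum>e\<in>P. ln (c e t))"
        using elim finP by (intro ln_prod) auto
      finally show ?thesis .
    qed
    then show ?case
      using elim by (simp add: add_divide_distrib diff_divide_distrib flip: sum_divide_distrib)
  qed
  ultimately show "((\<lambda>t. - ln (f t) / t) \<longlongrightarrow> (\<Sum>j\<in>C. vine_gauge H (p j) j x)) at_top"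
    unfolding G by (auto intro: Lim_transform_eventually)
qed

end

section \<open>Gauge functions on the closed orthant\<close>

text \<open>Asymptotic equivalence determines a gauge function on the open orthant. A limit different from zero
  excludes the degenerate case in which both sides of the equivalence vanish.\<close>

lemma gauge_function_eq_limit:
  assumes g: "gauge_function C f g" and x: "x \<in> PiE C (\<lambda>_. {0<..})"
    and lim: "((\<lambda>t. - ln (f (\<lambda>i\<in>C. t * x i)) / t) \<longlongrightarrow> L) at_top" and "L \<noteq> 0"
  shows "g x = L"
proof -
  have "(\<lambda>t. - ln (f (\<lambda>i\<in>C. t * x i))) \<sim>[at_top] (\<lambda>t. t * g x)"
    using g x by (simp add: gauge_function_def)
  from asymp_equivD[OF this]
  have 1: "((\<lambda>t. if - ln (f (\<lambda>i\<in>C. t * x i)) = 0 \<and> t * g x = 0 then 1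
      else - ln (f (\<lambda>i\<in>C. t * x i)) / (t * g x)) \<longlongrightarrow> 1) at_top" .
  have ne: "\<forall>\<^sub>F t in at_top. - ln (f (\<lambda>i\<in>C. t * x i)) / t \<noteq> 0"
    using tendsto_imp_eventually_ne[OF lim \<open>L \<noteq> 0\<close>] .
  have "((\<lambda>t. (- ln (f (\<lambda>i\<in>C. t * x i)) / t) * inverse (g x)) \<longlongrightarrow> 1) at_top"
    by (rule Lim_transform_eventually[OF 1]) (use ne in eventually_elim, simp add: field_simps)
  moreover have "((\<lambda>t. (- ln (f (\<lambda>i\<in>C. t * x i)) / t) * inverse (g x)) \<longlongrightarrow> L * inverse (g x)) at_top"
    by (intro tendsto_mult lim tendsto_const)
  ultimately have "L * inverse (g x) = 1"
    using tendsto_unique trivial_limit_at_top_linorder by blast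
  then show ?thesis
    by (cases "g x = 0") (auto simp: field_simps)
qed

lemma asymp_equiv_of_limit:
  fixes h :: "real \<Rightarrow> real"
  assumes "((\<lambda>t. h t / t) \<longlongrightarrow> L) at_top" "L \<noteq> 0"
  shows "h \<sim>[at_top] (\<lambda>t. t * L)"
proof (rule asymp_equivI')
  have "((\<lambda>t. h t / t / L) \<longlongrightarrow> L / L) at_top"
    using assms by (intro tendsto_divide tendsto_const) auto
  then show "((\<lambda>t. h t / (t * L)) \<longlongrightarrow> 1) at_top"
    using assms(2) by simp
qed

lemma continuous_on_restrict:
  fixes A :: "'i set" and S :: "('i \<Rightarrow> 'b::topological_space) set"
  shows "continuous_on S (\<lambda>x. restrict x A)"
proof (rule continuous_on_coordinatewise_then_product)
  fix i
  show "continuous_on S (\<lambda>x. restrict x A i)"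
    by (cases "i \<in> A")
      (auto intro: continuous_on_product_then_coordinatewise[OF continuous_on_id])
qed

lemma gauge_function_restrict:
  assumes g: "gauge_function C f g" and C: "C \<subseteq> D"
  shows "continuous_on (PiE D (\<lambda>_. {0..})) (\<lambda>x. g (restrict x C))"
    and "x \<in> PiE D (\<lambda>_. {0..}) \<Longrightarrow> 0 < t \<Longrightarrow> g (restrict (\<lambda>i\<in>D. t * x i) C) = t * g (restrict x C)"
proof -
  have restrict: "restrict x C \<in> PiE C (\<lambda>_. {0..})" if "x \<in> PiE D (\<lambda>_. {0..})" for x :: "nat \<Rightarrow> real"
    using that C by (simp add: restrict_PiE_iff PiE_iff subset_iff)
  have "continuous_on (PiE C (\<lambda>_. {0..})) g"
    using g by (simp add: gauge_function_def)
  then show "continuous_on (PiE D (\<lambda>_. {0..})) (\<lambda>x. g (restrict x C))"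
    by (rule continuous_on_compose2[OF _ continuous_on_restrict]) (use restrict in blast)
  show "g (restrict (\<lambda>i\<in>D. t * x i) C) = t * g (restrict x C)"
    if x: "x \<in> PiE D (\<lambda>_. {0..})" and "0 < t"
  proof -
    have "restrict (\<lambda>i\<in>D. t * x i) C = (\<lambda>i\<in>C. t * restrict x C i)"
      by (rule ext) (use C in \<open>auto simp: restrict_def\<close>)
    moreover have "\<forall>y\<in>PiE C (\<lambda>_. {0..}). \<forall>t>0. g (\<lambda>i\<in>C. t * y i) = t * g y"
      using g unfolding gauge_function_def by (elim conjE)
    from this[rule_format, OF restrict[OF x] \<open>0 < t\<close>]
    have "g (\<lambda>i\<in>C. t * restrict x C i) = t * g (restrict x C)" .
    ultimately show ?thesis
      by (simp only:)
  qed
qed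

text \<open>A boundary point \<open>x\<close> is approached from the open orthant by adding the same \<open>e > 0\<close> to all
  coordinates.\<close>

lemma nonneg_on_closed_orthant:
  fixes h :: "('i \<Rightarrow> real) \<Rightarrow> real"
  assumes cont: "continuous_on (PiE D (\<lambda>_. {0..})) h"
    and pos: "\<And>x. x \<in> PiE D (\<lambda>_. {0<..}) \<Longrightarrow> 0 \<le> h x" and x: "x \<in> PiE D (\<lambda>_. {0..})"
  shows "0 \<le> h x"
proof -
  define y where "y e = (\<lambda>i\<in>D. x i + e)" for e
  have x_nonneg: "0 \<le> x i" if "i \<in> D" for i
    using x that by auto
  have "y 0 = x"
    using x by (auto simp: y_def fun_eq_iff PiE_def extensional_def)
  have "continuous_on {0..} (\<lambda>e. y e i)" for i
    unfolding y_def by (cases "i \<in> D") (auto intro!: continuous_intros)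
  then have "continuous_on {0..} y"
    by (rule continuous_on_coordinatewise_then_product)
  moreover have "y ` {0..} \<subseteq> PiE D (\<lambda>_. {0..})"
    using x_nonneg by (auto simp: y_def)
  ultimately have c: "continuous_on (closure {0<..}) (\<lambda>e. h (y e))"
    using continuous_on_compose2[OF cont] by simp
  have p: "0 \<le> h (y e)" if "e \<in> {0<..}" for e
    using x_nonneg that by (intro pos) (auto simp: y_def intro!: add_nonneg_pos)
  have "0 \<le> h (y 0)"
    by (rule continuous_ge_on_closure[OF c _ p]) auto
  then show ?thesis
    using \<open>y 0 = x\<close> by simp
qed

section \<open>The gauge function of the vine\<close>

theorem mainTheorem5:
  fixes d :: nat
    and H :: "nat \<Rightarrow> nat \<Rightarrow> real measure"
    and V :: "nat \<Rightarrow> nat \<Rightarrow> ereal \<Rightarrow> ereal \<Rightarrow> real"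
    and M :: "'a measure"
    and X :: "'a \<Rightarrow> nat \<Rightarrow> real"
    and f g1 g2 g3 :: "(nat \<Rightarrow> real) \<Rightarrow> real"
  assumes "4 \<le> d"
    and "\<And>k j. 1 \<le> k \<Longrightarrow> k < j \<Longrightarrow> j \<le> d \<Longrightarrow>
           spectral_distribution (H k j) \<and> V k j = exponent_measure (H k j) \<and> regular_exponent (V k j)"
    and "f = cvine_density V {1..d}"
    and "\<And>x. (\<forall>i\<in>{1..d}. 0 < x i) \<Longrightarrow> 0 < f x"
    and "prob_space M"
    and "distributed M (PiM {1..d} (\<lambda>_. lborel)) X f"
    and "\<And>i. i \<in> {1..d} \<Longrightarrow> distributed M lborel (\<lambda>\<omega>. X \<omega> i) (exponential_density 1)"
    and "gauge_function ({1..d} - {d}) (cvine_density V ({1..d} - {d})) g1"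
    and "gauge_function ({1..d} - {d - 1}) (cvine_density V ({1..d} - {d - 1})) g2"
    and "gauge_function ({1..d} - {d - 1, d}) (cvine_density V ({1..d} - {d - 1, d})) g3"
  shows "gauge_function {1..d} f
           (\<lambda>x. g3 (restrict x ({1..d} - {d - 1, d})) +
                V (d - 1) d
                  (1 / ereal (g1 (restrict x ({1..d} - {d})) - g3 (restrict x ({1..d} - {d - 1, d}))))
                  (1 / ereal (g2 (restrict x ({1..d} - {d - 1})) - g3 (restrict x ({1..d} - {d - 1, d})))))"
proof -
  let ?D = "{1..d}" and ?C1 = "{1..d} - {d}" and ?C2 = "{1..d} - {d - 1}" and ?C3 = "{1..d} - {d - 1, d}"
  interpret ev_vine d H V
  proof
    fix k j assume "1 \<le> k" "k < j" "j \<le> d"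
    from assms(2)[OF this]
    show "spectral_distribution (H k j)" "regular_exponent (exponent_measure (H k j))"
      "V k j = exponent_measure (H k j)"
      by auto
  qed
  interpret nondegenerate_vine d H V
    by unfold_locales (rule edge_nondegenerate; use assms(3,4) in auto)
  define L where "L = tail_dependence (H (d - 1) d)"
  define u v where "u x = g1 (restrict x ?C1) - g3 (restrict x ?C3)"
    and "v x = g2 (restrict x ?C2) - g3 (restrict x ?C3)" for x
  interpret last: regular_spectral "H (d - 1) d"
    using assms(1) by (intro edge) auto
  have V_last: "V (d - 1) d = exponent_measure (H (d - 1) d)"
    using assms(1) by (intro V) auto
  obtain m where d: "d = Suc (Suc m)" and m: "2 \<le> m"
    using assms(1) by (intro that[of "d - 2"]) auto
  have subsets: "?C1 \<subseteq> ?D" "?C2 \<subseteq> ?D" "?C3 \<subseteq> ?D"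
    by auto
  have sets: "?D = insert d (insert (d - 1) {1..m})" "?C1 = insert (d - 1) {1..m}"
    "?C2 = insert d {1..m}" "?C3 = {1..m}"
    using d by auto

  \<comment> \<open>\<open>p C j\<close> counts the predecessors of \<open>j\<close> in \<open>C\<close>; only without \<open>d - 1\<close> is it not \<open>j - 1\<close>, namely for \<open>j = d\<close>\<close>
  define p where "p C j = (if d - 1 \<in> C then j - 1 else min (j - 1) m)" for C j
  define G where "G C x = (\<Sum>j\<in>C. vine_gauge H (p C j) j x)" for C x
  have limit: "((\<lambda>t. - ln (cvine_density V C (\<lambda>i\<in>C. t * x i)) / t) \<longlongrightarrow> G C x) at_top"
    and G_pos: "0 < G C x"
    if C: "C \<in> {?D, ?C1, ?C2, ?C3}" and x: "x \<in> PiE ?D (\<lambda>_. {0<..})" for C x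
  proof -
    have p: "{k \<in> C. k < j} = {1..p C j}" if "j \<in> C" for j
      using that C d by (auto simp: p_def)
    have sub: "C \<subseteq> ?D" "finite C" "1 \<in> C"
      using C m d by auto
    have pos: "0 < x i" if "i \<in> C" for i
      using x sub(1) that by auto
    show "((\<lambda>t. - ln (cvine_density V C (\<lambda>i\<in>C. t * x i)) / t) \<longlongrightarrow> G C x) at_top"
      unfolding G_def using subvine_limit[OF sub(1) p pos] by simp
    have "0 < vine_gauge H (p C j) j x" if "j \<in> C" for j
    proof (rule vine_gauge_pos)
      have j: "j \<in> ?D"
        using that sub by auto
      moreover have "p C j \<le> j - 1"
        by (simp add: p_def)
      ultimately show "p C j < j" "j \<le> d"
        by auto
      then show "0 < x j" "\<And>i. i \<in> {1..p C j} \<Longrightarrow> 0 < x i"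
        using x j by auto
    qed
    then show "0 < G C x"
      unfolding G_def using sub by (intro sum_pos) auto
  qed
  have gauge: "g (restrict x C) = G C x"
    if "gauge_function C (cvine_density V C) g" "C \<in> {?D, ?C1, ?C2, ?C3}" "x \<in> PiE ?D (\<lambda>_. {0<..})" for g C x
  proof (rule gauge_function_eq_limit[OF that(1)])
    have "C \<subseteq> ?D"
      using that(2) by auto
    then show "restrict x C \<in> PiE C (\<lambda>_. {0<..})"
      using that(3) by auto
    have "(\<lambda>i\<in>C. t * restrict x C i) = (\<lambda>i\<in>C. t * x i)" for t
      by auto
    then show "((\<lambda>t. - ln (cvine_density V C (\<lambda>i\<in>C. t * restrict x C i)) / t) \<longlongrightarrow> G C x) at_top"
      using limit[OF that(2,3)] by simp
    show "G C x \<noteq> 0"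
      using G_pos[OF that(2,3)] by (rule less_imp_neq[symmetric])
  qed

  have core: "(\<Sum>j\<in>{1..m}. vine_gauge H (p C j) j x) = (\<Sum>j\<in>{1..m}. vine_gauge H (j - 1) j x)" for C x
    by (intro sum.cong refl arg_cong2[where f = "\<lambda>k j. vine_gauge H k j x"]) (auto simp: p_def)
  have G_insert: "G (insert a C) x =
      vine_gauge H (p (insert a C) a) a x + (\<Sum>j\<in>C. vine_gauge H (p (insert a C) j) j x)"
    if "finite C" "a \<notin> C" for a C x
    using that by (simp add: G_def)
  have new: "d \<notin> {1..m}" "d - 1 \<notin> {1..m}" "d \<notin> insert (d - 1) {1..m}"
    using d by auto
  note fin = finite_atLeastAtMost[of 1 m]
  have G3: "G ?C3 x = (\<Sum>j\<in>{1..m}. vine_gauge H (j - 1) j x)" for x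
    unfolding sets(4) G_def core ..
  have G1: "G ?C1 x = G ?C3 x + vine_gauge H m (d - 1) x" for x
    unfolding G3 unfolding sets(2) G_insert[OF fin new(2)] core by (simp add: p_def d)
  have G2: "G ?C2 x = G ?C3 x + vine_gauge H m d x" for x
    unfolding G3 unfolding sets(3) G_insert[OF fin new(1)] core by (simp add: p_def d)
  have G0: "G ?D x = G ?C3 x + L (vine_gauge H m (d - 1) x) (vine_gauge H m d x)" for x
    unfolding G3 unfolding sets(1) G_insert[OF finite.insertI[OF fin] new(3)] sum.insert[OF fin new(2)] core
    by (simp add: p_def d L_def)
  have mem: "?C1 \<in> {?D, ?C1, ?C2, ?C3}" "?C2 \<in> {?D, ?C1, ?C2, ?C3}" "?C3 \<in> {?D, ?C1, ?C2, ?C3}"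
    by (rule insertI2, rule insertI1)
      (rule insertI2, rule insertI2, rule insertI1,
       rule insertI2, rule insertI2, rule insertI2, rule insertI1)
  have u: "u x = vine_gauge H m (d - 1) x" and v: "v x = vine_gauge H m d x"
    and total: "G ?D x = g3 (restrict x ?C3) + L (u x) (v x)"
    if x: "x \<in> PiE ?D (\<lambda>_. {0<..})" for x
    unfolding u_def v_def gauge[OF assms(8) mem(1) x] gauge[OF assms(9) mem(2) x] gauge[OF assms(10) mem(3) x]
    by (simp_all only: G0 G1 G2 add_diff_cancel_left')

  note cont = gauge_function_restrict(1)[OF assms(8) subsets(1)] gauge_function_restrict(1)[OF assms(9) subsets(2)]
    gauge_function_restrict(1)[OF assms(10) subsets(3)]
  note hom = gauge_function_restrict(2)[OF assms(8) subsets(1)] gauge_function_restrict(2)[OF assms(9) subsets(2)]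
    gauge_function_restrict(2)[OF assms(10) subsets(3)]
  have cont_uv: "continuous_on (PiE ?D (\<lambda>_. {0..})) u" "continuous_on (PiE ?D (\<lambda>_. {0..})) v"
    unfolding u_def v_def by (rule continuous_on_diff[OF cont(1) cont(3)], rule continuous_on_diff[OF cont(2) cont(3)])
  have uv_pos: "0 < u x" "0 < v x" if "x \<in> PiE ?D (\<lambda>_. {0<..})" for x
    unfolding u[OF that] v[OF that] by (rule vine_gauge_pos; use that d in auto)+
  have uv_nonneg: "0 \<le> u x" "0 \<le> v x" if "x \<in> PiE ?D (\<lambda>_. {0..})" for x
    using nonneg_on_closed_orthant[OF cont_uv(1) _ that] nonneg_on_closed_orthant[OF cont_uv(2) _ that]
      uv_pos less_imp_le by blast+

  have V_eq: "V (d - 1) d (1 / ereal (u x)) (1 / ereal (v x)) = L (u x) (v x)"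
    if "x \<in> PiE ?D (\<lambda>_. {0..})" for x
    unfolding V_last L_def using exponent_measure_inverse uv_nonneg[OF that] by (simp add: tail_dependence_def)
  show ?thesis
    unfolding gauge_function_def u_def[symmetric] v_def[symmetric]
  proof (intro conjI ballI allI impI)
    have "continuous_on (PiE ?D (\<lambda>_. {0..})) (\<lambda>x. g3 (restrict x ?C3) + L (u x) (v x))"
      unfolding L_def by (intro continuous_on_add cont(3) last.continuous_on_tail_dependence cont_uv)
    then show "continuous_on (PiE ?D (\<lambda>_. {0..}))
        (\<lambda>x. g3 (restrict x ?C3) + V (d - 1) d (1 / ereal (u x)) (1 / ereal (v x)))"
      by (rule continuous_on_eq) (simp only: V_eq)
  next
    fix x :: "nat \<Rightarrow> real" and t :: real assume x: "x \<in> PiE ?D (\<lambda>_. {0..})" and t: "0 < t"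
    let ?y = "\<lambda>i\<in>?D. t * x i"
    note homs = hom[OF x t]
    have y: "?y \<in> PiE ?D (\<lambda>_. {0..})"
      using x t by (simp add: restrict_PiE_iff PiE_iff)
    have uv: "u ?y = t * u x" "v ?y = t * v x"
      unfolding u_def v_def homs by (simp_all add: algebra_simps)
    show "g3 (restrict ?y ?C3) + V (d - 1) d (1 / ereal (u ?y)) (1 / ereal (v ?y)) =
        t * (g3 (restrict x ?C3) + V (d - 1) d (1 / ereal (u x)) (1 / ereal (v x)))"
      unfolding V_eq[OF x] V_eq[OF y]
      unfolding homs uv L_def last.tail_dependence_mult[OF less_imp_le[OF t]]
      by (simp only: distrib_left)
  next
    fix x :: "nat \<Rightarrow> real" assume x: "x \<in> PiE ?D (\<lambda>_. {0<..})"
    then have x': "x \<in> PiE ?D (\<lambda>_. {0..})"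
      by (simp add: PiE_iff less_imp_le)
    show "\<forall>\<^sub>F t in at_top. 0 < f (\<lambda>i\<in>?D. t * x i)"
      using eventually_gt_at_top[of 0] by eventually_elim (rule assms(4), use x in \<open>simp add: PiE_iff\<close>)
    show "(\<lambda>t. - ln (f (\<lambda>i\<in>?D. t * x i))) \<sim>[at_top]
        (\<lambda>t. t * (g3 (restrict x ?C3) + V (d - 1) d (1 / ereal (u x)) (1 / ereal (v x))))"
      unfolding V_eq[OF x'] total[OF x, symmetric]
      by (rule asymp_equiv_of_limit) (use limit[of ?D x] G_pos[of ?D x] x in \<open>simp_all add: assms(3)\<close>)
  qed
qed

end
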